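(* Let $G$ be a graph of order $n$ with $\min\{\delta(G),\delta(\overline{G})\}\geq k-1$. If $k\geq 2$, then \[ \gamma_{\times(k-1)}^{r}(G)+\gamma_{\times(k-1)}^{r}(\overline{G})\leq \gamma_{\times k}^{r}(G\overline{G}), \] and if $k\geq 1$, then \[ \gamma_{\times k}^{r}(G\overline{G})\leq \gamma_{\times k}^{r}(G)+\gamma_{\times k}^{r}(\overline{G}). \]
   Context: All graphs are finite, simple and undirected; $\overline{G}$ is the complement of $G$. The complementary prism $G\overline{G}$ is formed from the disjoint union of $G$ and $\overline{G}$ by adding the edges of a perfect matching joining each vertex of $G$ to its corresponding copy in $\overline{G}$. For an integer $j\geq 1$ and a graph $H=(V,E)$ with $\delta(H)\geq j-1$, with $N[x]$ the closed neighborhood of $x$: $S\subseteq V$ is a $j$-tuple restrained dominating set if $|N[x]\cap S|\geq j$ for all $x\in V$ and every vertex of $V-S$ has at least $j$ neighbors in $V-S$; $\gamma_{\times j}^{r}(H)$ is the minimum cardinality of such a set. *)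

theory Defs
  imports "Graph_Theory.Pair_Digraph"
begin

text \<open>
  A finite simple undirected graph is a \<^locale>\<open>pair_graph\<close>: a finite, loop-free, symmetric set of
  ordered pairs. An undirected edge is thus stored as two opposite arcs, so that the degree of a
  vertex is its out-degree. The null graph is not excluded.
\<close>

definition nbhd :: "'a pair_pre_digraph \<Rightarrow> 'a \<Rightarrow> 'a set" where
  "nbhd H x = {y. (x, y) \<in> parcs H}"

definition closed_nbhd :: "'a pair_pre_digraph \<Rightarrow> 'a \<Rightarrow> 'a set" where
  "closed_nbhd H x = insert x (nbhd H x)"

text \<open>The value of \<open>min_degree\<close> on the null graph is unspecified.\<close>

definition min_degree :: "'a pair_pre_digraph \<Rightarrow> nat" where
  "min_degree H = Min (out_degree (with_proj H) ` pverts H)"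

definition complement_graph :: "'a pair_pre_digraph \<Rightarrow> 'a pair_pre_digraph" where
  "complement_graph G = \<lparr> pverts = pverts G,
     parcs = {(u, v). u \<in> pverts G \<and> v \<in> pverts G \<and> u \<noteq> v \<and> (u, v) \<notin> parcs G} \<rparr>"

text \<open>\<open>Inl v\<close> is the vertex \<open>v\<close> of \<open>G\<close>, and \<open>Inr v\<close> is its copy in the complement of \<open>G\<close>.\<close>

definition complementary_prism :: "'a pair_pre_digraph \<Rightarrow> ('a + 'a) pair_pre_digraph" where
  "complementary_prism G = \<lparr> pverts = pverts G <+> pverts (complement_graph G),
     parcs = {(Inl u, Inl v) | u v. (u, v) \<in> parcs G}
           \<union> {(Inr u, Inr v) | u v. (u, v) \<in> parcs (complement_graph G)}
           \<union> {(Inl v, Inr v) | v. v \<in> pverts G}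
           \<union> {(Inr v, Inl v) | v. v \<in> pverts G} \<rparr>"

definition tuple_restrained_dominating ::
    "nat \<Rightarrow> 'a pair_pre_digraph \<Rightarrow> 'a set \<Rightarrow> bool" where
  "tuple_restrained_dominating j H S \<longleftrightarrow>
     S \<subseteq> pverts H \<and>
     (\<forall>x \<in> pverts H. card (closed_nbhd H x \<inter> S) \<ge> j) \<and>
     (\<forall>x \<in> pverts H - S. card (nbhd H x \<inter> (pverts H - S)) \<ge> j)"

text \<open>
  The number is meaningful only if a set as above exists. This is the case if the minimum degree
  is at least \<open>j - 1\<close>, see \<open>tuple_restrained_dominating_verts\<close> below.
\<close>

definition tuple_restrained_domination_number :: "nat \<Rightarrow> 'a pair_pre_digraph \<Rightarrow> nat" where
  "tuple_restrained_domination_number j H =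
     (LEAST c. \<exists>S. tuple_restrained_dominating j H S \<and> card S = c)"

lemma pair_graph_complement_graph:
  assumes "pair_graph G"
  shows "pair_graph (complement_graph G)"
proof -
  interpret pair_graph G by fact
  have "finite (parcs (complement_graph G))"
    by (rule finite_subset[of _ "pverts G \<times> pverts G"]) (auto simp: complement_graph_def)
  then show ?thesis
    by unfold_locales
      (auto simp: complement_graph_def symmetric_def sym_def intro: arcs_symmetric)
qed

lemma pair_graph_complementary_prism:
  assumes "pair_graph G"
  shows "pair_graph (complementary_prism G)"
proof -
  interpret pair_graph G by fact
  interpret C: pair_graph "complement_graph G"
    using assms by (rule pair_graph_complement_graph)
  have V: "pverts (complement_graph G) = pverts G"
    by (simp add: complement_graph_def)
  have sub: "parcs (complementary_prism G)
      \<subseteq> pverts (complementary_prism G) \<times> pverts (complementary_prism G)"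
    by (auto simp: complementary_prism_def V
        dest: in_arcsD1 in_arcsD2 C.in_arcsD1 C.in_arcsD2)
  have fin: "finite (pverts (complementary_prism G))"
    by (simp add: complementary_prism_def V)
  show ?thesis
  proof unfold_locales
    show "finite (parcs (complementary_prism G))"
      using finite_subset[OF sub] fin by blast
    show "symmetric (with_proj (complementary_prism G))"
      by (auto simp: complementary_prism_def symmetric_def sym_def
          intro: arcs_symmetric C.arcs_symmetric)
    show "fst e \<noteq> snd e" if "e \<in> parcs (complementary_prism G)" for e
      using that by (auto simp: complementary_prism_def dest: no_loops' C.no_loops')
  qed (use sub fin in auto)
qed

lemma tuple_restrained_dominating_verts:
  assumes "pair_graph H" and "min_degree H \<ge> j - 1"
  shows "tuple_restrained_dominating j H (pverts H)"
proof -
  interpret pair_graph H by fact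
  have "card (closed_nbhd H x \<inter> pverts H) \<ge> j" if x: "x \<in> pverts H" for x
  proof -
    have sub: "nbhd H x \<subseteq> pverts H" and nx: "x \<notin> nbhd H x"
      by (auto simp: nbhd_def dest: in_arcsD2 no_loops')
    have "out_arcs (with_proj H) x = Pair x ` nbhd H x"
      by (auto simp: nbhd_def)
    then have "out_degree (with_proj H) x = card (nbhd H x)"
      by (simp add: out_degree_def card_image inj_on_def)
    moreover have "min_degree H \<le> out_degree (with_proj H) x"
      unfolding min_degree_def using x by (intro Min_le) auto
    moreover have "closed_nbhd H x \<inter> pverts H = insert x (nbhd H x)"
      using sub x by (auto simp: closed_nbhd_def)
    moreover have "finite (nbhd H x)"
      using sub pair_finite_verts by (rule finite_subset)
    ultimately show ?thesis
      using assms(2) nx by simp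
  qed
  then show ?thesis
    by (simp add: tuple_restrained_dominating_def)
qed

end

theory Submission
  imports Defs
begin

text \<open>
  A set of vertices of the prism is a disjoint sum \<open>A <+> B\<close>, where \<open>A\<close> lies in the graph and \<open>B\<close>
  in its complement. A vertex has exactly one neighbour on the other side, so a neighbourhood count
  in the prism is at least the count within the vertex's own side, and exceeds it by at most one.
\<close>

lemma Plus_Int_Plus: "(A <+> B) \<inter> (C <+> D) = (A \<inter> C) <+> (B \<inter> D)"
  by auto

lemma Plus_Diff_Plus: "(A <+> B) - (C <+> D) = (A - C) <+> (B - D)"
  by auto

lemma pverts_complement_graph [simp]: "pverts (complement_graph G) = pverts G"
  by (simp add: complement_graph_def)

lemma pverts_complementary_prism:
  "pverts (complementary_prism G) = pverts G <+> pverts G"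
  by (simp add: complementary_prism_def)

lemma nbhd_complementary_prism:
  assumes "x \<in> pverts G"
  shows "nbhd (complementary_prism G) (Inl x) = nbhd G x <+> {x}"
    and "nbhd (complementary_prism G) (Inr x) = {x} <+> nbhd (complement_graph G) x"
  using assms by (auto simp: nbhd_def complementary_prism_def)

lemma closed_nbhd_complementary_prism:
  assumes "x \<in> pverts G"
  shows "closed_nbhd (complementary_prism G) (Inl x) = closed_nbhd G x <+> {x}"
    and "closed_nbhd (complementary_prism G) (Inr x) =
      {x} <+> closed_nbhd (complement_graph G) x"
  using assms by (auto simp: closed_nbhd_def nbhd_complementary_prism)

lemma finite_nbhd:
  assumes "pair_graph H"
  shows "finite (nbhd H x)" and "finite (closed_nbhd H x)"
proof -
  interpret pair_graph H by fact
  have "nbhd H x \<subseteq> pverts H"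
    by (auto simp: nbhd_def dest: in_arcsD2)
  then show "finite (nbhd H x)"
    using pair_finite_verts by (rule finite_subset)
  then show "finite (closed_nbhd H x)"
    by (simp add: closed_nbhd_def)
qed

text \<open>\<open>N\<close> stands for an open or closed neighbourhood within one side, and
  \<open>{x}\<close> for the matching partner, which counts only if it lies in \<open>B\<close>. The
  two orders of the sum serve the vertices \<open>Inl x\<close> and \<open>Inr x\<close>.\<close>

lemma card_Plus_singleton_Int:
  assumes "finite N"
  shows "card (N \<inter> A) \<le> card ((N \<inter> A) <+> ({x} \<inter> B))"
    and "card (N \<inter> A) \<le> card (({x} \<inter> B) <+> (N \<inter> A))"
    and "card ((N \<inter> A) <+> ({x} \<inter> B)) \<le> card (N \<inter> A) + 1"
    and "card (({x} \<inter> B) <+> (N \<inter> A)) \<le> card (N \<inter> A) + 1"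
  using assms by (simp_all add: card_Plus Int_insert_left)

text \<open>Every vertex keeps the neighbours it has on its own side, and these alone already reach
  \<open>j\<close>, both inside the set and outside it. The partner can only add to either
  count.\<close>

lemma tuple_restrained_dominating_prism:
  assumes "pair_graph G"
    and "tuple_restrained_dominating j G A"
    and "tuple_restrained_dominating j (complement_graph G) B"
  shows "tuple_restrained_dominating j (complementary_prism G) (A <+> B)"
proof -
  \<comment> \<open>Facts 1 and 2 are for the open and the closed neighbourhood in \<open>G\<close>,
    facts 3 and 4 for those in the complement.\<close>
  note finite = finite_nbhd[OF assms(1)]
    finite_nbhd[OF pair_graph_complement_graph[OF assms(1)]]
  note card = card_Plus_singleton_Int
  note prism = pverts_complementary_prism Plus_Int_Plus Plus_Diff_Plus
    nbhd_complementary_prism closed_nbhd_complementary_prism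
  have A: "A \<subseteq> pverts G"
      "\<And>x. x \<in> pverts G \<Longrightarrow> j \<le> card (closed_nbhd G x \<inter> A)"
      "\<And>x. x \<in> pverts G - A \<Longrightarrow> j \<le> card (nbhd G x \<inter> (pverts G - A))"
    using assms(2) unfolding tuple_restrained_dominating_def by blast+
  have B: "B \<subseteq> pverts G"
      "\<And>x. x \<in> pverts G \<Longrightarrow> j \<le> card (closed_nbhd (complement_graph G) x \<inter> B)"
      "\<And>x. x \<in> pverts G - B \<Longrightarrow>
        j \<le> card (nbhd (complement_graph G) x \<inter> (pverts G - B))"
    using assms(3) unfolding tuple_restrained_dominating_def pverts_complement_graph by blast+
  show ?thesis
    unfolding tuple_restrained_dominating_def pverts_complementary_prism Plus_Diff_Plus
  proof (intro conjI ballI)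
    show "A <+> B \<subseteq> pverts G <+> pverts G"
      using A(1) B(1) by blast
    show "j \<le> card (closed_nbhd (complementary_prism G) y \<inter> (A <+> B))"
      if y: "y \<in> pverts G <+> pverts G" for y
      using y
    proof (elim PlusE)
      fix x assume "x \<in> pverts G" "y = Inl x"
      then show ?thesis
        using A(2)[of x] card(1)[OF finite(2)[of x], where x = x and A = A and B = B] by (simp add: prism)
    next
      fix x assume "x \<in> pverts G" "y = Inr x"
      then show ?thesis
        using B(2)[of x] card(2)[OF finite(4)[of x], where x = x and A = B and B = A] by (simp add: prism)
    qed
    show "j \<le> card (nbhd (complementary_prism G) y \<inter> ((pverts G - A) <+> (pverts G - B)))"
      if y: "y \<in> (pverts G - A) <+> (pverts G - B)" for y
      using y
    proof (elim PlusE)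
      fix x assume "x \<in> pverts G - A" "y = Inl x"
      then show ?thesis
        using A(3)[of x] card(1)[OF finite(1)[of x], where x = x and A = "pverts G - A" and B = "pverts G - B"]
        by (simp add: prism)
    next
      fix x assume "x \<in> pverts G - B" "y = Inr x"
      then show ?thesis
        using B(3)[of x] card(2)[OF finite(3)[of x], where x = x and A = "pverts G - B" and B = "pverts G - A"]
        by (simp add: prism)
    qed
  qed
qed

text \<open>Restricting to one side removes at most the partner from each count, so the threshold
  drops by at most one. For \<open>j = 0\<close> truncated subtraction leaves it at 0.\<close>

lemma tuple_restrained_dominating_prism_sides:
  assumes "pair_graph G"
    and "tuple_restrained_dominating j (complementary_prism G) (A <+> B)"
  shows "tuple_restrained_dominating (j - 1) G A"
    and "tuple_restrained_dominating (j - 1) (complement_graph G) B"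
proof -
  note finite = finite_nbhd[OF assms(1)]
    finite_nbhd[OF pair_graph_complement_graph[OF assms(1)]]
  note card = card_Plus_singleton_Int
  note prism = pverts_complementary_prism Plus_Int_Plus Plus_Diff_Plus
    nbhd_complementary_prism closed_nbhd_complementary_prism
  have S: "A <+> B \<subseteq> pverts G <+> pverts G"
    and dom: "\<And>x. x \<in> pverts G <+> pverts G \<Longrightarrow>
      j \<le> card (closed_nbhd (complementary_prism G) x \<inter> (A <+> B))"
    and restr: "\<And>x. x \<in> (pverts G - A) <+> (pverts G - B) \<Longrightarrow>
      j \<le> card (nbhd (complementary_prism G) x \<inter> ((pverts G - A) <+> (pverts G - B)))"
    using assms(2) unfolding tuple_restrained_dominating_def
    by (simp_all add: pverts_complementary_prism Plus_Diff_Plus)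
  show "tuple_restrained_dominating (j - 1) G A"
    unfolding tuple_restrained_dominating_def
  proof (intro conjI ballI)
    show "A \<subseteq> pverts G" using S by auto
    show "j - 1 \<le> card (closed_nbhd G x \<inter> A)" if "x \<in> pverts G" for x
      \<comment> \<open>Of the at least \<open>j\<close> elements counted in the prism, at most one
        is the partner \<open>Inr x\<close>; the others lie in \<open>G\<close>.\<close>
      using dom[of "Inl x"] card(3)[OF finite(2)[of x], where x = x and A = A and B = B] that by (simp add: prism InlI)
    show "j - 1 \<le> card (nbhd G x \<inter> (pverts G - A))" if "x \<in> pverts G - A" for x
      using restr[of "Inl x"] card(3)[OF finite(1)[of x], where x = x and A = "pverts G - A" and B = "pverts G - B"] that
      by (simp add: prism InlI)
  qed
  show "tuple_restrained_dominating (j - 1) (complement_graph G) B"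
    unfolding tuple_restrained_dominating_def pverts_complement_graph
  proof (intro conjI ballI)
    show "B \<subseteq> pverts G" using S by auto
    show "j - 1 \<le> card (closed_nbhd (complement_graph G) x \<inter> B)" if "x \<in> pverts G" for x
      using dom[of "Inr x"] card(4)[OF finite(4)[of x], where x = x and A = B and B = A] that by (simp add: prism InrI)
    show "j - 1 \<le> card (nbhd (complement_graph G) x \<inter> (pverts G - B))"
      if "x \<in> pverts G - B" for x
      using restr[of "Inr x"] card(4)[OF finite(3)[of x], where x = x and A = "pverts G - B" and B = "pverts G - A"] that
      by (simp add: prism InrI)
  qed
qed

lemma tuple_restrained_domination_number_le:
  "tuple_restrained_dominating j H S \<Longrightarrow> tuple_restrained_domination_number j H \<le> card S"
  unfolding tuple_restrained_domination_number_def by (rule Least_le) blast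

text \<open>\<open>LEAST\<close> is unspecified when no set qualifies; the premise supplies one, so
  the minimum is attained.\<close>

lemma tuple_restrained_domination_number_attained:
  assumes "tuple_restrained_dominating j H S"
  obtains T where "tuple_restrained_dominating j H T"
    and "card T = tuple_restrained_domination_number j H"
  using assms LeastI_ex[of "\<lambda>c. \<exists>S. tuple_restrained_dominating j H S \<and> card S = c"]
  unfolding tuple_restrained_domination_number_def by blast

text \<open>Finiteness is what allows the cardinality of a disjoint sum to be split by
  \<open>card_Plus\<close>.\<close>

lemma tuple_restrained_dominating_finite:
  assumes "pair_graph H" and "tuple_restrained_dominating j H S"
  shows "finite S"
proof -
  interpret pair_graph H by fact
  have "S \<subseteq> pverts H"
    using assms(2) by (simp add: tuple_restrained_dominating_def)
  then show ?thesis
    using pair_finite_verts by (rule finite_subset)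
qed

theorem theorem5p5:
  fixes G :: "'a pair_pre_digraph" and n k :: nat
  assumes "pair_graph G"
    and "card (pverts G) = n"
    and "min (min_degree G) (min_degree (complement_graph G)) \<ge> k - 1"
  shows "(k \<ge> 2 \<longrightarrow>
            tuple_restrained_domination_number (k - 1) G
              + tuple_restrained_domination_number (k - 1) (complement_graph G)
            \<le> tuple_restrained_domination_number k (complementary_prism G))
       \<and> (k \<ge> 1 \<longrightarrow>
            tuple_restrained_domination_number k (complementary_prism G)
            \<le> tuple_restrained_domination_number k G
              + tuple_restrained_domination_number k (complement_graph G))"
proof -
  note C = pair_graph_complement_graph[OF assms(1)]
  \<comment> \<open>The degree hypothesis enters here: the whole vertex set qualifies, its restraint
    condition being vacuous, so a minimum set exists. The complement is treated likewise.\<close>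
  have "tuple_restrained_dominating k G (pverts G)"
    using assms(1,3) by (simp add: tuple_restrained_dominating_verts)
  then obtain A where A: "tuple_restrained_dominating k G A"
      "card A = tuple_restrained_domination_number k G"
    by (rule tuple_restrained_domination_number_attained)
  have "tuple_restrained_dominating k (complement_graph G) (pverts (complement_graph G))"
    using C assms(3) by (intro tuple_restrained_dominating_verts) simp_all
  then obtain B where B: "tuple_restrained_dominating k (complement_graph G) B"
      "card B = tuple_restrained_domination_number k (complement_graph G)"
    by (rule tuple_restrained_domination_number_attained)
  \<comment> \<open>This set is used twice: its size gives the upper bound, and its existence
    guarantees a minimum set \<open>S\<close> of the prism for the lower bound.\<close>
  have AB: "tuple_restrained_dominating k (complementary_prism G) (A <+> B)"
    using assms(1) A(1) B(1) by (rule tuple_restrained_dominating_prism)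
  have upper: "tuple_restrained_domination_number k (complementary_prism G)
      \<le> tuple_restrained_domination_number k G
        + tuple_restrained_domination_number k (complement_graph G)"
    using tuple_restrained_domination_number_le[OF AB] A B
      tuple_restrained_dominating_finite[OF assms(1) A(1)]
      tuple_restrained_dominating_finite[OF C B(1)]
    by (simp add: card_Plus)
  obtain S where S: "tuple_restrained_dominating k (complementary_prism G) S"
      "card S = tuple_restrained_domination_number k (complementary_prism G)"
    using AB by (rule tuple_restrained_domination_number_attained)
  \<comment> \<open>Any subset of a sum type is the disjoint sum of its two preimages, which brings
    \<open>S\<close> into the form required for passing to the sides.\<close>
  define A' B' where "A' = Inl -` S" and "B' = Inr -` S"
  have S_eq: "S = A' <+> B'"
  proof (rule set_eqI)
    show "x \<in> S \<longleftrightarrow> x \<in> A' <+> B'" for x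
      by (cases x) (auto simp: A'_def B'_def)
  qed
  note sides = tuple_restrained_dominating_prism_sides[OF assms(1) S(1)[unfolded S_eq]]
  have "card S = card A' + card B'"
    using tuple_restrained_dominating_finite[OF assms(1) sides(1)]
      tuple_restrained_dominating_finite[OF C sides(2)]
    by (simp add: S_eq card_Plus)
  \<comment> \<open>\<open>A'\<close> and \<open>B'\<close> qualify for \<open>k - 1\<close> but
    need not be minimum there, hence only an inequality.\<close>
  then have "tuple_restrained_domination_number (k - 1) G
      + tuple_restrained_domination_number (k - 1) (complement_graph G)
      \<le> tuple_restrained_domination_number k (complementary_prism G)"
    using S(2) sides[THEN tuple_restrained_domination_number_le] by simp
  with upper show ?thesis by simp
qed

end
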